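(* Let $\mathcal{L}$ be a finite distributive lattice and let $\sigma\subset N\otimes\mathbb{R}$ be the cone associated to the Hibi toric variety $X_{\mathcal{L}}$. Then $\sigma$ is generated, as a convex cone, by $$\{e_z : z\in M(J_{\mathcal{L}})\}\ \cup\ \{v_{y,y'} : (y,y')\in Z(J_{\mathcal{L}})\},\qquad v_{y,y'}:=e_{y'}-e_y.$$
   Context: $K$ is an algebraically closed field of arbitrary characteristic. $\mathcal{L}$ is a finite distributive lattice with join $\vee$ and meet $\wedge$. $J_{\mathcal{L}}$ is the poset (with induced order) of join-irreducible elements, i.e. those $z\in\mathcal{L}$ such that $z=x\vee y$ implies $z=x$ or $z=y$ (so the minimal element $\hat 0$ belongs to $J_{\mathcal{L}}$). For $\alpha\in\mathcal{L}$, $I_\alpha=\{\theta\in J_{\mathcal{L}} : \theta\le\alpha\}$. The Hibi toric variety $X_{\mathcal{L}}\subset\mathbb{A}^{\#\mathcal{L}}$ is the affine variety whose vanishing ideal in $K[X_\alpha,\alpha\in\mathcal{L}]$ is the (prime) ideal generated by all $X_\alpha X_\beta-X_{\alpha\vee\beta}X_{\alpha\wedge\beta}$, $\alpha,\beta\in\mathcal{L}$. Let $T=(K^* )^{J_{\mathcal{L}}}$, $M=X(T)$ its character group with $\mathbb{Z}$-basis the coordinate characters $f_z$, $z\in J_{\mathcal{L}}$, and $N$ the $\mathbb{Z}$-dual of $M$ with dual basis $e_z$, $z\in J_{\mathcal{L}}$. Put $f_{I_\alpha}=\sum_{z\in I_\alpha}f_z$. The map $t\mapsto (f_{I_\alpha}(t))_{\alpha\in\mathcal{L}}$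 embeds $T$ as a dense open subset of $X_{\mathcal{L}}$ and makes $X_{\mathcal{L}}$ a normal affine toric variety; $\sigma\subset N\otimes\mathbb{R}$ is the strongly convex rational polyhedral cone such that $K[X_{\mathcal{L}}]$ (viewed inside $K[T]=K[M]$) equals the semigroup algebra $K[\sigma^\vee\cap M]$. $M(J_{\mathcal{L}})$ is the set of maximal elements of the poset $J_{\mathcal{L}}$. $Z(J_{\mathcal{L}})$ is the set of covers in $J_{\mathcal{L}}$, i.e. pairs $(y,y')$ with $y>y'$ in $J_{\mathcal{L}}$ and no $x\in J_{\mathcal{L}}$ with $y>x>y'$. *)

theory Defs
  imports
    "HOL-Analysis.Analysis"
    "HOL-Computational_Algebra.Polynomial"
    "HOL-Library.Poly_Mapping"
    "HOL-Library.FuncSet"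
begin

subsection \<open>The poset of join-irreducible elements\<close>

text \<open>With this convention the least element of a finite lattice is join-irreducible.\<close>

definition join_irreducible :: "'l::semilattice_sup \<Rightarrow> bool" where
  "join_irreducible z \<longleftrightarrow> (\<forall>x y. z = sup x y \<longrightarrow> z = x \<or> z = y)"

lemma join_irreducible_exists: "\<exists>z::'l::{finite,distrib_lattice}. join_irreducible z"
proof -
  obtain z :: 'l where z: "\<forall>x\<in>UNIV. x \<le> z \<longrightarrow> z = x"
    using finite_has_minimal[of "UNIV :: 'l set"] by auto
  have "join_irreducible z"
    unfolding join_irreducible_def using z by (metis UNIV_I sup_ge1)
  then show ?thesis ..
qed

typedef (overloaded) 'l jirr = "{z::'l::{finite,distrib_lattice}. join_irreducible z}"
  using join_irreducible_exists by blast

instance jirr :: ("{finite,distrib_lattice}") finite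
proof
  have "finite (Rep_jirr ` (UNIV :: 'a jirr set))"
    by simp
  then show "finite (UNIV :: 'a jirr set)"
    by (rule finite_imageD) (simp add: inj_on_def Rep_jirr_inject)
qed

instantiation jirr :: ("{finite,distrib_lattice}") order
begin

definition less_eq_jirr :: "'a jirr \<Rightarrow> 'a jirr \<Rightarrow> bool" where
  "y \<le> z \<longleftrightarrow> Rep_jirr y \<le> Rep_jirr z"

definition less_jirr :: "'a jirr \<Rightarrow> 'a jirr \<Rightarrow> bool" where
  "y < z \<longleftrightarrow> Rep_jirr y < Rep_jirr z"

instance
  by standard
    (auto simp: less_eq_jirr_def less_jirr_def less_le_not_le simp flip: Rep_jirr_inject)

end

definition ideal_below :: "'l::{finite,distrib_lattice} \<Rightarrow> 'l jirr set" where
  "ideal_below \<alpha> = {\<theta>. Rep_jirr \<theta> \<le> \<alpha>}"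

definition maximal_jirr :: "'l::{finite,distrib_lattice} jirr set" where
  "maximal_jirr = {z. \<not> (\<exists>w. z < w)}"

definition covers_jirr :: "('l::{finite,distrib_lattice} jirr \<times> 'l jirr) set" where
  "covers_jirr = {(y, y'). y > y' \<and> \<not> (\<exists>x. y > x \<and> x > y')}"


subsection \<open>Polynomials and affine varieties\<close>

text \<open>
  Polynomials in variables indexed by \<open>'l\<close> are finitely supported functions from monomials
  (finitely supported exponent functions) to coefficients, with the convolution product.
  Points of the affine space are functions \<open>'l \<Rightarrow> 'k\<close>.
\<close>

type_synonym ('l, 'k) mpoly = "('l \<Rightarrow>\<^sub>0 nat) \<Rightarrow>\<^sub>0 'k"

definition Var :: "'l \<Rightarrow> ('l, 'k::comm_ring_1) mpoly" where
  "Var \<alpha> = Poly_Mapping.single (Poly_Mapping.single \<alpha> 1) 1"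

definition eval_mpoly :: "('l, 'k::comm_ring_1) mpoly \<Rightarrow> ('l \<Rightarrow> 'k) \<Rightarrow> 'k" where
  "eval_mpoly p x = (\<Sum>m\<in>Poly_Mapping.keys p.
     Poly_Mapping.lookup p m *
       (\<Prod>\<alpha>\<in>Poly_Mapping.keys m. x \<alpha> ^ Poly_Mapping.lookup m \<alpha>))"

definition zero_locus :: "('l, 'k::comm_ring_1) mpoly set \<Rightarrow> ('l \<Rightarrow> 'k) set" where
  "zero_locus I = {x. \<forall>p\<in>I. eval_mpoly p x = 0}"

text \<open>
  The coordinate ring of \<open>X\<close>, i.e. polynomials modulo those vanishing on \<open>X\<close>, is
  represented as the ring of polynomial functions on \<open>X\<close>.
\<close>

definition coordinate_ring :: "('l \<Rightarrow> 'k::comm_ring_1) set \<Rightarrow> (('l \<Rightarrow> 'k) \<Rightarrow> 'k) set" where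
  "coordinate_ring X = {restrict (eval_mpoly p) X | p. True}"


subsection \<open>The Hibi toric variety\<close>

text \<open>The ideal generated by a set is its span in the ring as a module over itself.\<close>

definition hibi_ideal :: "('l::{finite,distrib_lattice}, 'k::comm_ring_1) mpoly set" where
  "hibi_ideal = module.span (*)
     {Var \<alpha> * Var \<beta> - Var (sup \<alpha> \<beta>) * Var (inf \<alpha> \<beta>) | \<alpha> \<beta>. True}"

text \<open>
  An affine variety is the zero locus of its vanishing ideal, so the variety with vanishing
  ideal \<^const>\<open>hibi_ideal\<close> is the following set.
\<close>

definition hibi_variety :: "('l::{finite,distrib_lattice} \<Rightarrow> 'k::alg_closed_field) set" where
  "hibi_variety = zero_locus hibi_ideal"


subsection \<open>The torus and its embedding\<close>

definition torus :: "('j::finite \<Rightarrow> 'k::field) set" where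
  "torus = {t. \<forall>z. t z \<noteq> 0}"

text \<open>
  The character lattice \<open>M\<close> and its dual \<open>N\<close> are both \<open>int ^ 'j\<close>; the bases \<open>f\<^sub>z\<close> and \<open>e\<^sub>z\<close> are
  given by \<^term>\<open>axis z 1\<close>, and the pairing, extended to \<open>real ^ 'j\<close>, is the inner product.
\<close>

definition character :: "int ^ 'j::finite \<Rightarrow> ('j \<Rightarrow> 'k::field) \<Rightarrow> 'k" where
  "character m t = (\<Prod>z\<in>UNIV. t z powi (m $ z))"

text \<open>
  The semigroup algebra \<open>K[S]\<close>, for \<open>S \<subseteq> M\<close>, inside the ring \<open>K[T] = K[M]\<close> of regular
  functions on the torus.
\<close>

definition semigroup_algebra :: "(int ^ 'j::finite) set \<Rightarrow> (('j \<Rightarrow> 'k::field) \<Rightarrow> 'k) set" where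
  "semigroup_algebra S =
     {(\<lambda>t\<in>torus. \<Sum>m\<in>A. c m * character m t) | A c. finite A \<and> A \<subseteq> S}"

definition f_ideal :: "'l::{finite,distrib_lattice} \<Rightarrow> int ^ 'l jirr" where
  "f_ideal \<alpha> = (\<Sum>z\<in>ideal_below \<alpha>. axis z 1)"

definition hibi_embedding ::
    "('l::{finite,distrib_lattice} jirr \<Rightarrow> 'k::field) \<Rightarrow> 'l \<Rightarrow> 'k" where
  "hibi_embedding t = (\<lambda>\<alpha>. character (f_ideal \<alpha>) t)"

text \<open>\<open>K[X]\<close> viewed inside \<open>K[T]\<close>, by pulling back along the embedding of the torus.\<close>

definition hibi_algebra ::
    "(('l::{finite,distrib_lattice} jirr \<Rightarrow> 'k::alg_closed_field) \<Rightarrow> 'k) set" where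
  "hibi_algebra = {(\<lambda>t\<in>torus. \<phi> (hibi_embedding t)) | \<phi>. \<phi> \<in> coordinate_ring hibi_variety}"


subsection \<open>Cones\<close>

definition real_vec :: "int ^ 'j::finite \<Rightarrow> real ^ 'j" where
  "real_vec m = (\<chi> z. of_int (m $ z))"

definition dual_cone :: "'a::real_inner set \<Rightarrow> 'a set" where
  "dual_cone \<sigma> = {u. \<forall>v\<in>\<sigma>. u \<bullet> v \<ge> 0}"

definition rational_polyhedral_cone :: "(real ^ 'j::finite) set \<Rightarrow> bool" where
  "rational_polyhedral_cone \<sigma> \<longleftrightarrow> (\<exists>G. finite G \<and> \<sigma> = convex_cone hull (real_vec ` G))"

definition strongly_convex :: "'a::real_vector set \<Rightarrow> bool" where
  "strongly_convex \<sigma> \<longleftrightarrow> \<sigma> \<inter> uminus ` \<sigma> = {0}"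

text \<open>
  The cone \<open>\<sigma>\<close> with \<open>K[X] = K[\<sigma>\<^sup>\<or> \<inter> M]\<close>; the field \<open>K\<close> enters as a type argument.
\<close>

definition hibi_cone ::
    "'k::alg_closed_field itself \<Rightarrow> (real ^ 'l::{finite,distrib_lattice} jirr) set" where
  "hibi_cone _ = (THE \<sigma>. rational_polyhedral_cone \<sigma> \<and> strongly_convex \<sigma> \<and>
     (hibi_algebra :: (('l jirr \<Rightarrow> 'k) \<Rightarrow> 'k) set) =
       semigroup_algebra {m. real_vec m \<in> dual_cone \<sigma>})"

definition e_vec :: "'j::finite \<Rightarrow> real ^ 'j" where
  "e_vec z = axis z 1"

definition v_vec :: "'j::finite \<Rightarrow> 'j \<Rightarrow> real ^ 'j" where
  "v_vec y y' = e_vec y' - e_vec y"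

end

theory Submission
  imports Defs
begin

text \<open>
  The cone \<open>\<sigma>\<close> is pinned down by its dual, so everything is computed on the side of the characters.
  Write \<open>\<sigma>\<^sub>0\<close> for the cone generated by the vectors \<open>e\<^sub>z\<close> and \<open>v\<^bsub>y,y'\<^esub>\<close>.  A functional is nonnegative on
  them iff its coordinates decrease along covers and are nonnegative at maximal elements; as the
  poset is finite, this says that it is a nonnegative order-reversing function on \<open>J\<^sub>\<L>\<close>
  (\<open>dual_cone_cover_generators\<close>).

  On the algebraic side, \<open>K[X\<^sub>\<L>]\<close> is spanned by the characters that are sums of the \<open>f\<^bsub>I\<^sub>\<alpha>\<^esub>\<close>, that is,
  sums of indicator functions of nonempty down-sets of \<open>J\<^sub>\<L>\<close> (Birkhoff's theorem).  Subtracting the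
  indicator function of the support again and again shows that these sums are exactly the
  nonnegative order-reversing integer functions (\<open>range_hibi_exponent\<close>).  Therefore \<open>\<sigma>\<^sub>0\<close> is one of
  the cones with \<open>K[X\<^sub>\<L>] = K[\<sigma>\<^sup>\<or> \<inter> M]\<close>.

  It is the only one.  Characters are linearly independent over \<open>K\<close>, so \<open>K[S]\<close> determines \<open>S\<close>
  (\<open>character_in_semigroup_algebra_iff\<close>), and it remains to recover a closed convex cone from the
  integral points of its dual.  In general this rests on the density of rational points in the
  dual cone.  Here there is a direct substitute: the strictly decreasing integral functional
  \<open>h\<^sub>z = #{w. z \<le> w}\<close> stays in the dual after subtraction of any vector with coordinates in \<open>[0,1)\<close>,
  so \<open>\<lfloor>n u\<rfloor> + h\<close> is an integral point of the dual within bounded distance of \<open>n u\<close>, for each \<open>u\<close>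
  in the dual (\<open>mem_cone_if_integral_dual_nonneg\<close>).
\<close>


section \<open>Order-reversing functions and the cone of covers\<close>

definition antitone_cone :: "('a::linordered_idom ^ 'j::{finite,order}) set" where
  "antitone_cone = {u. (\<forall>z. 0 \<le> u $ z) \<and> (\<forall>y z. y \<le> z \<longrightarrow> u $ z \<le> u $ y)}"

definition cover_generators :: "(real ^ 'j::{finite,order}) set" where
  "cover_generators =
     {e_vec z | z. \<not> (\<exists>w. z < w)} \<union> {v_vec y y' | y y'. y > y' \<and> \<not> (\<exists>x. y > x \<and> x > y')}"

text \<open>
  A strict inequality that is not a cover splits into two with smaller open intervals; induction
  on the size of the open interval applies.
\<close>

lemma antitone_if_antitone_on_covers:
  fixes f :: "'j::{finite,order} \<Rightarrow> 'b::order"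
  assumes covers: "\<And>y y'. y > y' \<Longrightarrow> \<not> (\<exists>x. y > x \<and> x > y') \<Longrightarrow> f y \<le> f y'"
    and "y' \<le> y"
  shows "f y \<le> f y'"
  using \<open>y' \<le> y\<close>
proof (induction "card {x. y' < x \<and> x < y}" arbitrary: y y' rule: less_induct)
  case less
  show ?case
  proof (cases "y' < y \<and> (\<exists>x. y > x \<and> x > y')")
    case True
    then obtain x where x: "y' < x" "x < y" by blast
    have "card {v. y' < v \<and> v < x} < card {v. y' < v \<and> v < y}"
      by (rule psubset_card_mono) (use x in auto)
    moreover have "card {v. x < v \<and> v < y} < card {v. y' < v \<and> v < y}"
      by (rule psubset_card_mono) (use x in auto)
    ultimately show ?thesis
      using less.hyps x by (meson less_imp_le order_trans)
  next
    case False
    then show ?thesis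
      using covers less.prems by (cases "y' = y") auto
  qed
qed

lemma inner_e_vec: "u \<bullet> e_vec z = u $ z"
  by (simp add: e_vec_def inner_axis)

lemma inner_v_vec: "u \<bullet> v_vec y y' = u $ y' - u $ y"
  by (simp add: v_vec_def inner_diff_right inner_e_vec)

lemma dual_cone_cover_generators:
  "dual_cone cover_generators = (antitone_cone :: (real ^ 'j::{finite,order}) set)"
proof (intro set_eqI iffI)
  fix u :: "real ^ 'j::{finite,order}"
  assume u: "u \<in> dual_cone cover_generators"
  have maximal: "0 \<le> u $ z" if "\<not> (\<exists>w. z < w)" for z
    using u that unfolding dual_cone_def cover_generators_def
    by (force simp flip: inner_e_vec)
  have cover: "u $ y \<le> u $ y'" if "y > y'" "\<not> (\<exists>x. y > x \<and> x > y')" for y y'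
  proof -
    have "v_vec y y' \<in> cover_generators"
      using that unfolding cover_generators_def by blast
    then have "0 \<le> u \<bullet> v_vec y y'"
      using u unfolding dual_cone_def by blast
    then show ?thesis
      by (simp add: inner_v_vec)
  qed
  have antitone: "u $ z \<le> u $ y" if "y \<le> z" for y z
    using antitone_if_antitone_on_covers[of "\<lambda>z. u $ z"] cover that by blast
  have "0 \<le> u $ z" for z
  proof -
    obtain w where "z \<le> w" "\<forall>v\<in>UNIV. w \<le> v \<longrightarrow> w = v"
      using finite_has_maximal2[of UNIV z] by auto
    then have "0 \<le> u $ w"
      by (intro maximal) (auto simp: less_le)
    with antitone[OF \<open>z \<le> w\<close>] show ?thesis
      by simp
  qed
  with antitone show "u \<in> antitone_cone"
    by (simp add: antitone_cone_def)
next
  fix u :: "real ^ 'j::{finite,order}"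
  assume "u \<in> antitone_cone"
  then show "u \<in> dual_cone cover_generators"
    by (auto simp: antitone_cone_def dual_cone_def cover_generators_def inner_e_vec inner_v_vec
        less_imp_le)
qed

lemma dual_cone_hull: "dual_cone (convex_cone hull G) = dual_cone G"
proof
  show "dual_cone (convex_cone hull G) \<subseteq> dual_cone G"
    by (auto simp: dual_cone_def hull_inc)
  show "dual_cone G \<subseteq> dual_cone (convex_cone hull G)"
  proof
    fix u
    assume "u \<in> dual_cone G"
    then have "convex_cone hull G \<subseteq> {v. u \<bullet> v \<ge> 0}"
      by (intro hull_minimal convex_cone_halfspace_ge) (auto simp: dual_cone_def)
    then show "u \<in> dual_cone (convex_cone hull G)"
      unfolding dual_cone_def by blast
  qed
qed

lemma real_vec_in_antitone_cone_iff: "real_vec m \<in> antitone_cone \<longleftrightarrow> m \<in> antitone_cone"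
  by (simp add: antitone_cone_def real_vec_def)

text \<open>
  The function \<open>h\<close> counts the elements above a given one.  It is at least 1 and drops by at least
  1 along every strict inequality, and subtracting values from \<open>[0,1)\<close> costs less than that.
\<close>

lemma antitone_cone_absorbs_fractions:
  "\<exists>h :: int ^ 'j::{finite,order}.
     \<forall>u. (\<forall>z. 0 \<le> u $ z) \<longrightarrow> (\<forall>z. u $ z < 1) \<longrightarrow> real_vec h - u \<in> antitone_cone"
proof (intro exI allI impI)
  fix u :: "real ^ 'j::{finite,order}"
  assume "\<forall>z. 0 \<le> u $ z" and "\<forall>z. u $ z < 1"
  then have u0: "0 \<le> u $ z" and u1: "u $ z < 1" for z
    by auto
  let ?h = "(\<chi> z. int (card {w. z \<le> w})) :: int ^ 'j::{finite,order}"
  have pos: "1 \<le> card {w. z \<le> w}" for z :: 'j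
  proof -
    have "z \<in> {w. z \<le> w}"
      by simp
    then show ?thesis
      by (metis One_nat_def Suc_leI card_gt_0_iff empty_iff finite)
  qed
  have dec: "card {w. z \<le> w} + 1 \<le> card {w. y \<le> w}" if "y < z" for y z :: 'j
  proof -
    have "{w. z \<le> w} \<subset> {w. y \<le> w}"
      using that by (auto dest: less_le_trans)
    from psubset_card_mono[OF finite this] show ?thesis
      by linarith
  qed
  have "0 \<le> real (card {w. z \<le> w}) - u $ z" for z
    using pos[of z] u1[of z] by linarith
  moreover have "real (card {w. z \<le> w}) - u $ z \<le> real (card {w. y \<le> w}) - u $ y" if "y \<le> z" for y z
  proof (cases "y = z")
    case False
    with that have "card {w. z \<le> w} + 1 \<le> card {w. y \<le> w}"
      by (intro dec) (simp add: less_le)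
    then show ?thesis
      using u0[of z] u1[of y] by linarith
  qed simp
  ultimately show "real_vec ?h - u \<in> antitone_cone"
    unfolding antitone_cone_def real_vec_def by simp
qed

text \<open>
  A point outside \<open>\<sigma>\<close> is separated from it by some real \<open>u\<close> in the dual.  The integral point
  \<open>\<lfloor>n u\<rfloor> + h\<close> lies in the dual too and differs from \<open>n u\<close> by a bounded amount, so for large \<open>n\<close>
  it separates as well.
\<close>

lemma mem_cone_if_integral_dual_nonneg:
  fixes \<sigma> :: "(real ^ 'j::{finite,order}) set"
  assumes cone: "convex_cone \<sigma>" and "closed \<sigma>"
    and antitone: "antitone_cone \<subseteq> dual_cone \<sigma>"
    and integral: "\<And>m. real_vec m \<in> dual_cone \<sigma> \<Longrightarrow> 0 \<le> real_vec m \<bullet> w"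
  shows "w \<in> \<sigma>"
proof (rule ccontr)
  assume "w \<notin> \<sigma>"
  then obtain u b where ub: "u \<bullet> w < b" "\<And>x. x \<in> \<sigma> \<Longrightarrow> b < u \<bullet> x"
    using separating_hyperplane_closed_point[of \<sigma> w] cone \<open>closed \<sigma>\<close>
    unfolding convex_cone_def by blast
  have "b < 0"
    using ub(2)[of 0] convex_cone_contains_0[OF cone] by simp
  have u_dual: "u \<in> dual_cone \<sigma>"
    unfolding dual_cone_def
  proof (intro CollectI ballI, rule ccontr)
    fix x
    assume "x \<in> \<sigma>" and neg: "\<not> 0 \<le> u \<bullet> x"
    \<comment> \<open>The multiple of \<open>x\<close> at which \<open>u\<close> takes the value \<open>b\<close> lies in the cone.\<close>
    have "(b / (u \<bullet> x)) *\<^sub>R x \<in> \<sigma>"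
      using \<open>b < 0\<close> neg by (intro convex_cone_scaleR cone \<open>x \<in> \<sigma>\<close>) (simp add: divide_nonpos_nonpos)
    from ub(2)[OF this] show False
      using neg by simp
  qed
  obtain h :: "int ^ 'j::{finite,order}" where h:
    "\<And>u. (\<And>z. 0 \<le> u $ z) \<Longrightarrow> (\<And>z. u $ z < 1) \<Longrightarrow> real_vec h - u \<in> antitone_cone"
    using antitone_cone_absorbs_fractions by blast
  define B where "B = (\<Sum>z\<in>UNIV. (\<bar>real_of_int (h $ z)\<bar> + 1) * \<bar>w $ z\<bar>)"
  have bound: "0 \<le> real n * (u \<bullet> w) + B" for n
  proof -
    define r :: "real ^ 'j::{finite,order}" where "r = real_vec h - (\<chi> z. frac (real n * u $ z))"
    define m :: "int ^ 'j::{finite,order}" where "m = h + (\<chi> z. \<lfloor>real n * u $ z\<rfloor>)"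
    have m: "real_vec m = real n *\<^sub>R u + r"
      by (simp add: vec_eq_iff m_def r_def real_vec_def frac_def)
    have "r \<in> dual_cone \<sigma>"
      using antitone h[of "\<chi> z. frac (real n * u $ z)"] by (auto simp: r_def frac_lt_1)
    then have "real_vec m \<in> dual_cone \<sigma>"
      using u_dual by (simp add: m dual_cone_def inner_add_left)
    then have "0 \<le> real n * (u \<bullet> w) + r \<bullet> w"
      using integral[of m] by (simp add: m inner_add_left)
    moreover have "r \<bullet> w \<le> B"
      unfolding B_def inner_vec_def
    proof (rule sum_mono)
      fix z
      have "r $ z = real_of_int (h $ z) - frac (real n * u $ z)"
        by (simp add: r_def real_vec_def)
      then have "\<bar>r $ z\<bar> \<le> \<bar>real_of_int (h $ z)\<bar> + 1"
        using frac_ge_0[of "real n * u $ z"] frac_lt_1[of "real n * u $ z"] by linarith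
      then have "\<bar>r $ z\<bar> * \<bar>w $ z\<bar> \<le> (\<bar>real_of_int (h $ z)\<bar> + 1) * \<bar>w $ z\<bar>"
        by (intro mult_right_mono) auto
      then show "r $ z \<bullet> w $ z \<le> (\<bar>real_of_int (h $ z)\<bar> + 1) * \<bar>w $ z\<bar>"
        using abs_ge_self[of "r $ z * w $ z"] unfolding inner_real_def abs_mult by linarith
    qed
    ultimately show ?thesis
      by linarith
  qed
  have "0 < - (u \<bullet> w)"
    using ub(1) \<open>b < 0\<close> by simp
  then obtain n where "B < real n * - (u \<bullet> w)"
    using reals_Archimedean3 by blast
  with bound[of n] show False
    unfolding mult_minus_right by linarith
qed

lemma finite_cover_generators: "finite (cover_generators :: (real ^ 'j::{finite,order}) set)"
proof -
  have "cover_generators \<subseteq> range e_vec \<union> range (\<lambda>(y, y' :: 'j). v_vec y y')"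
    by (auto simp: cover_generators_def)
  then show ?thesis
    by (rule finite_subset) simp
qed

lemma antitone_cone_subset_dual_hull:
  "antitone_cone \<subseteq> dual_cone (convex_cone hull cover_generators)"
  by (simp add: dual_cone_hull dual_cone_cover_generators)

text \<open>
  If both \<open>x\<close> and \<open>- x\<close> lie in the cone, then \<open>x\<close> is orthogonal to the dual, which contains \<open>h\<close> and
  \<open>h - axis z (1/2)\<close> for every \<open>z\<close>; so each coordinate of \<open>x\<close> vanishes.
\<close>

lemma strongly_convex_cover_hull:
  "strongly_convex (convex_cone hull (cover_generators :: (real ^ 'j::{finite,order}) set))"
proof -
  let ?\<sigma> = "convex_cone hull (cover_generators :: (real ^ 'j::{finite,order}) set)"
  obtain h :: "int ^ 'j::{finite,order}" where h:
    "\<And>u. (\<And>z. 0 \<le> u $ z) \<Longrightarrow> (\<And>z. u $ z < 1) \<Longrightarrow> real_vec h - u \<in> antitone_cone"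
    using antitone_cone_absorbs_fractions by blast
  have "x = 0" if "x \<in> ?\<sigma>" "- x \<in> ?\<sigma>" for x
  proof -
    have orthogonal: "u \<bullet> x = 0" if "u \<in> antitone_cone" for u
    proof -
      have "u \<in> dual_cone ?\<sigma>"
        using that antitone_cone_subset_dual_hull by blast
      then have "0 \<le> u \<bullet> x" "0 \<le> u \<bullet> - x"
        using \<open>x \<in> ?\<sigma>\<close> \<open>- x \<in> ?\<sigma>\<close> unfolding dual_cone_def by blast+
      then show ?thesis
        by simp
    qed
    have "x $ z = 0" for z
    proof -
      have "real_vec h - 0 \<in> antitone_cone"
        by (rule h) simp_all
      moreover have "real_vec h - axis z (1/2) \<in> antitone_cone"
        by (rule h) (auto simp: axis_def)
      ultimately have "(real_vec h - 0) \<bullet> x - (real_vec h - axis z (1/2)) \<bullet> x = 0"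
        using orthogonal by simp
      then show ?thesis
        by (simp add: inner_diff_left inner_axis')
    qed
    then show ?thesis
      by (simp add: vec_eq_iff)
  qed
  then show ?thesis
    by (auto simp: strongly_convex_def convex_cone_hull_contains_0 image_iff)
qed

lemma rational_polyhedral_cover_hull:
  "rational_polyhedral_cone (convex_cone hull (cover_generators :: (real ^ 'j::{finite,order}) set))"
proof -
  have e: "e_vec z = real_vec (axis z 1)" for z :: 'j
    by (simp add: vec_eq_iff e_vec_def real_vec_def axis_def)
  have v: "v_vec y y' = real_vec (axis y' 1 - axis y 1)" for y y' :: 'j
    by (simp add: vec_eq_iff v_vec_def e_vec_def real_vec_def axis_def)
  have "cover_generators \<subseteq> range (real_vec :: _ \<Rightarrow> real ^ 'j::{finite,order})"
    unfolding cover_generators_def using e v by blast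
  from finite_subset_image[OF finite_cover_generators this]
  obtain G :: "(int ^ 'j::{finite,order}) set" where "finite G" "cover_generators = real_vec ` G"
    by blast
  then show ?thesis
    by (auto simp: rational_polyhedral_cone_def)
qed

text \<open>
  The order of the two inclusions matters: the second one applies
  \<open>mem_cone_if_integral_dual_nonneg\<close> to \<open>\<sigma>\<close>, whose dual is known to contain all real
  order-reversing functions, not just the integral ones, only because \<open>\<sigma>\<close> lies in the generated
  cone.
\<close>

lemma cone_eq_cover_hull:
  fixes \<sigma> :: "(real ^ 'j::{finite,order}) set"
  assumes "rational_polyhedral_cone \<sigma>"
    and dual: "{m. real_vec m \<in> dual_cone \<sigma>} = antitone_cone"
  shows "\<sigma> = convex_cone hull cover_generators"
proof
  let ?\<sigma>\<^sub>0 = "convex_cone hull cover_generators :: (real ^ 'j::{finite,order}) set"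
  have dual\<^sub>0: "dual_cone ?\<sigma>\<^sub>0 = antitone_cone"
    by (simp add: dual_cone_hull dual_cone_cover_generators)
  show sub: "\<sigma> \<subseteq> ?\<sigma>\<^sub>0"
  proof
    fix w
    assume "w \<in> \<sigma>"
    show "w \<in> ?\<sigma>\<^sub>0"
    proof (rule mem_cone_if_integral_dual_nonneg)
      show "0 \<le> real_vec m \<bullet> w" if "real_vec m \<in> dual_cone ?\<sigma>\<^sub>0" for m
      proof -
        have "m \<in> {m. real_vec m \<in> dual_cone \<sigma>}"
          using that by (simp only: dual dual\<^sub>0 real_vec_in_antitone_cone_iff)
        then show ?thesis
          using \<open>w \<in> \<sigma>\<close> by (simp add: dual_cone_def)
      qed
    qed (simp_all add: convex_cone_convex_cone_hull closed_convex_cone_hull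
        finite_cover_generators dual\<^sub>0)
  qed
  obtain G where "finite G" and \<sigma>: "\<sigma> = convex_cone hull (real_vec ` G)"
    using assms(1) by (auto simp: rational_polyhedral_cone_def)
  show "?\<sigma>\<^sub>0 \<subseteq> \<sigma>"
  proof
    fix w
    assume "w \<in> ?\<sigma>\<^sub>0"
    show "w \<in> \<sigma>"
    proof (rule mem_cone_if_integral_dual_nonneg)
      show "convex_cone \<sigma>"
        by (simp add: \<sigma> convex_cone_convex_cone_hull)
      show "closed \<sigma>"
        using \<open>finite G\<close> by (simp add: \<sigma> closed_convex_cone_hull)
      show "antitone_cone \<subseteq> dual_cone \<sigma>"
        using sub by (auto simp: dual_cone_def simp flip: dual\<^sub>0)
      show "0 \<le> real_vec m \<bullet> w" if "real_vec m \<in> dual_cone \<sigma>" for m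
      proof -
        have "real_vec m \<in> dual_cone ?\<sigma>\<^sub>0"
          using that dual unfolding dual\<^sub>0 real_vec_in_antitone_cone_iff by blast
        then show ?thesis
          using \<open>w \<in> ?\<sigma>\<^sub>0\<close> by (simp add: dual_cone_def)
      qed
    qed
  qed
qed


section \<open>Linear independence of characters\<close>

text \<open>Over a finite field, 1 plus the product of all \<open>X - a\<close> would be a polynomial without a root.\<close>

lemma infinite_alg_closed_field: "infinite (UNIV :: 'k::alg_closed_field set)"
proof
  assume fin: "finite (UNIV :: 'k set)"
  define p :: "'k poly" where "p = (\<Prod>a\<in>UNIV. [:- a, 1:])"
  have "degree p = card (UNIV :: 'k set)"
    unfolding p_def by (subst degree_prod_eq_sum_degree) auto
  then have "degree (p + 1) > 0"
    using fin by (subst degree_add_eq_left) (auto simp: card_gt_0_iff)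
  then obtain x where "poly (p + 1) x = 0"
    using alg_closed_imp_poly_has_root by blast
  moreover have "poly p x = 0"
    using fin by (auto simp: p_def poly_prod)
  ultimately show False
    by simp
qed

lemma ex_power_int_neq:
  assumes "k \<noteq> l"
  shows "\<exists>x::'k::alg_closed_field. x \<noteq> 0 \<and> x powi k \<noteq> x powi l"
  using assms
proof (induction k l rule: linorder_wlog)
  case (le k l)
  define n where "n = nat (l - k)"
  have n: "n > 0" "l = k + int n"
    using le by (auto simp: n_def)
  have "coeff (monom 1 n - 1 :: 'k poly) n \<noteq> 0"
    using n(1) by simp
  then have "(monom 1 n - 1 :: 'k poly) \<noteq> 0"
    by force
  then have "finite (insert 0 {x::'k. poly (monom 1 n - 1) x = 0})"
    using poly_roots_finite by blast
  then obtain x :: 'k where "x \<notin> insert 0 {x. poly (monom 1 n - 1) x = 0}"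
    using ex_new_if_finite[OF infinite_alg_closed_field] by blast
  then have "x \<noteq> 0" "x ^ n \<noteq> 1"
    by (auto simp: poly_monom)
  then show ?case
    by (intro exI[of _ x]) (simp add: n(2) power_int_add)
next
  case (sym k l)
  then show ?case by metis
qed

lemma character_separates:
  assumes "m \<noteq> n"
  obtains t :: "'j::finite \<Rightarrow> 'k::alg_closed_field"
  where "t \<in> torus" "character m t \<noteq> character n t"
proof -
  obtain z where "m $ z \<noteq> n $ z"
    using assms by (auto simp: vec_eq_iff)
  then obtain x :: 'k where x: "x \<noteq> 0" "x powi (m $ z) \<noteq> x powi (n $ z)"
    using ex_power_int_neq by blast
  define t where "t w = (if w = z then x else 1)" for w
  have "character m t = x powi (m $ z)" for m
  proof -
    have "character m t = (\<Prod>w\<in>UNIV. if w = z then x powi (m $ z) else 1)"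
      unfolding character_def by (rule prod.cong) (auto simp: t_def)
    then show ?thesis
      by simp
  qed
  with x show thesis
    by (intro that[of t]) (auto simp: torus_def t_def)
qed

lemma character_mult_arg: "character m (\<lambda>z. s z * t z) = character m s * character m t"
  by (simp add: character_def power_int_mult_distrib prod.distrib)

lemma character_nonzero: "t \<in> torus \<Longrightarrow> character m t \<noteq> 0"
  by (auto simp: character_def torus_def)

text \<open>
  Dedekind's argument: translating a relation by \<open>s\<close> and subtracting \<open>\<chi>\<^sub>m(s)\<close> times the original one
  eliminates the character \<open>\<chi>\<^sub>m\<close>.
\<close>

lemma characters_independent:
  fixes c :: "int ^ 'j::finite \<Rightarrow> 'k::alg_closed_field"
  assumes "finite A"
    and "\<And>t. t \<in> torus \<Longrightarrow> (\<Sum>m\<in>A. c m * character m t) = 0"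
    and "m \<in> A"
  shows "c m = 0"
  using assms
proof (induction A arbitrary: c m rule: finite_induct)
  case (insert n A)
  have vanish: "c a = 0" if a: "a \<in> A" for a
  proof -
    obtain s :: "'j \<Rightarrow> 'k" where s: "s \<in> torus" "character a s \<noteq> character n s"
      using character_separates[of a n] a insert.hyps by metis
    have "c a * (character a s - character n s) = 0"
    proof (rule insert.IH[OF _ a])
      fix t :: "'j \<Rightarrow> 'k"
      assume t: "t \<in> torus"
      then have "(\<lambda>z. s z * t z) \<in> torus"
        using s by (simp add: torus_def)
      from insert.prems(1)[OF this] insert.hyps
      have 1: "c n * (character n s * character n t) +
          (\<Sum>m\<in>A. c m * (character m s * character m t)) = 0"
        by (simp add: character_mult_arg)
      have 2: "c n * character n t + (\<Sum>m\<in>A. c m * character m t) = 0"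
        using insert.prems(1)[OF t] insert.hyps by simp
      have "(\<Sum>m\<in>A. c m * (character m s - character n s) * character m t) =
          (\<Sum>m\<in>A. c m * (character m s * character m t))
            - character n s * (\<Sum>m\<in>A. c m * character m t)"
        by (simp add: sum_distrib_left algebra_simps sum_subtractf)
      also have "\<dots> = 0"
        using 1 2 by algebra
      finally show "(\<Sum>m\<in>A. c m * (character m s - character n s) * character m t) = 0" .
    qed
    with s show ?thesis
      by simp
  qed
  have one: "(\<lambda>_. 1) \<in> (torus :: ('j \<Rightarrow> 'k) set)"
    by (simp add: torus_def)
  from insert.prems(1)[OF one] insert.hyps vanish
  have "c n * character n (\<lambda>_. 1) = 0"
    by simp
  then have "c n = 0"
    using character_nonzero[OF one] by simp
  with vanish insert.prems(2) show ?case
    by auto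
qed simp

lemma character_in_semigroup_algebra_iff:
  "(\<lambda>t\<in>torus. character m t :: 'k::alg_closed_field) \<in> semigroup_algebra S \<longleftrightarrow> m \<in> S"
proof
  assume "m \<in> S"
  have "(\<lambda>t\<in>torus. character m t :: 'k) = (\<lambda>t\<in>torus. \<Sum>n\<in>{m}. 1 * character n t)"
    by simp
  with \<open>m \<in> S\<close> show "(\<lambda>t\<in>torus. character m t :: 'k) \<in> semigroup_algebra S"
    unfolding semigroup_algebra_def
    by (intro CollectI exI[of _ "{m}"] exI[of _ "\<lambda>_. 1"] conjI) auto
next
  assume "(\<lambda>t\<in>torus. character m t :: 'k) \<in> semigroup_algebra S"
  then obtain A and c :: "_ \<Rightarrow> 'k" where A: "finite A" "A \<subseteq> S" and eq:
    "(\<lambda>t\<in>torus. character m t) = (\<lambda>t\<in>torus. \<Sum>n\<in>A. c n * character n t)"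
    unfolding semigroup_algebra_def by blast
  show "m \<in> S"
  proof (rule ccontr)
    assume "m \<notin> S"
    with A have m: "m \<notin> A" by blast
    define d where "d = c(m := -1)"
    have "(\<Sum>n\<in>insert m A. d n * character n t) = 0" if t: "t \<in> torus" for t
    proof -
      have "(\<Sum>n\<in>A. d n * character n t) = (\<Sum>n\<in>A. c n * character n t)"
        by (rule sum.cong) (use m in \<open>auto simp: d_def\<close>)
      also have "\<dots> = character m t"
        using fun_cong[OF eq, of t] t by simp
      finally show ?thesis
        using A m by (simp add: d_def)
    qed
    then have "d m = 0"
      using characters_independent[of "insert m A" d m] A by blast
    then show False
      by (simp add: d_def)
  qed
qed

lemma semigroup_algebra_inject:
  assumes "(semigroup_algebra S :: (('j::finite \<Rightarrow> 'k::alg_closed_field) \<Rightarrow> 'k) set) = semigroup_algebra S'"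
  shows "S = S'"
  using assms by (metis character_in_semigroup_algebra_iff subsetI subset_antisym)


section \<open>Evaluation of polynomials\<close>

lemma eval_mpoly_eq_sum:
  fixes x :: "'l::finite \<Rightarrow> 'k::comm_ring_1"
  assumes "finite A" "Poly_Mapping.keys p \<subseteq> A"
  shows "eval_mpoly p x =
    (\<Sum>m\<in>A. Poly_Mapping.lookup p m * (\<Prod>\<alpha>\<in>UNIV. x \<alpha> ^ Poly_Mapping.lookup m \<alpha>))"
proof -
  have "(\<Prod>\<alpha>\<in>Poly_Mapping.keys m. x \<alpha> ^ Poly_Mapping.lookup m \<alpha>) =
      (\<Prod>\<alpha>\<in>UNIV. x \<alpha> ^ Poly_Mapping.lookup m \<alpha>)" for m
    by (rule prod.mono_neutral_left) (auto simp: in_keys_iff)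
  then have "eval_mpoly p x = (\<Sum>m\<in>Poly_Mapping.keys p.
      Poly_Mapping.lookup p m * (\<Prod>\<alpha>\<in>UNIV. x \<alpha> ^ Poly_Mapping.lookup m \<alpha>))"
    by (simp add: eval_mpoly_def)
  also have "\<dots> = (\<Sum>m\<in>A. Poly_Mapping.lookup p m * (\<Prod>\<alpha>\<in>UNIV. x \<alpha> ^ Poly_Mapping.lookup m \<alpha>))"
    using assms by (intro sum.mono_neutral_left) (auto simp: in_keys_iff)
  finally show ?thesis .
qed

lemma eval_mpoly_single:
  fixes x :: "'l::finite \<Rightarrow> 'k::comm_ring_1"
  shows "eval_mpoly (Poly_Mapping.single m a) x = a * (\<Prod>\<alpha>\<in>UNIV. x \<alpha> ^ Poly_Mapping.lookup m \<alpha>)"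
  by (subst eval_mpoly_eq_sum[of "{m}"]) auto

lemma eval_mpoly_0: "eval_mpoly 0 x = 0"
  by (simp add: eval_mpoly_def)

lemma eval_mpoly_add:
  fixes x :: "'l::finite \<Rightarrow> 'k::comm_ring_1"
  shows "eval_mpoly (p + q) x = eval_mpoly p x + eval_mpoly q x"
proof -
  let ?A = "Poly_Mapping.keys p \<union> Poly_Mapping.keys q"
  have "Poly_Mapping.keys (p + q) \<subseteq> ?A"
    by (rule keys_add)
  then show ?thesis
    by (simp add: eval_mpoly_eq_sum[of ?A] lookup_add distrib_right sum.distrib)
qed

lemma eval_mpoly_diff:
  fixes x :: "'l::finite \<Rightarrow> 'k::comm_ring_1"
  shows "eval_mpoly (p - q) x = eval_mpoly p x - eval_mpoly q x"
  using eval_mpoly_add[of "p - q" q x] by simp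

lemma eval_mpoly_sum:
  fixes x :: "'l::finite \<Rightarrow> 'k::comm_ring_1"
  shows "eval_mpoly (\<Sum>i\<in>A. p i) x = (\<Sum>i\<in>A. eval_mpoly (p i) x)"
  by (induction A rule: infinite_finite_induct) (auto simp: eval_mpoly_add eval_mpoly_0)

lemma mpoly_eq_sum_monomials:
  "p = (\<Sum>m\<in>Poly_Mapping.keys p. Poly_Mapping.single m (Poly_Mapping.lookup p m))"
  by (rule poly_mapping_eqI)
    (auto simp: lookup_sum lookup_single when_def in_keys_iff sum.delta)

lemma eval_mpoly_mult:
  fixes x :: "'l::finite \<Rightarrow> 'k::comm_ring_1"
  shows "eval_mpoly (p * q) x = eval_mpoly p x * eval_mpoly q x"
proof -
  let ?c = "Poly_Mapping.lookup"
  let ?X = "\<lambda>m. \<Prod>\<alpha>\<in>UNIV. x \<alpha> ^ ?c m \<alpha>"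
  have "p * q = (\<Sum>m\<in>Poly_Mapping.keys p. \<Sum>n\<in>Poly_Mapping.keys q.
      Poly_Mapping.single (m + n) (?c p m * ?c q n))"
    by (subst mpoly_eq_sum_monomials[of p], subst mpoly_eq_sum_monomials[of q])
      (simp add: sum_product mult_single)
  then have "eval_mpoly (p * q) x = (\<Sum>m\<in>Poly_Mapping.keys p. \<Sum>n\<in>Poly_Mapping.keys q.
      (?c p m * ?X m) * (?c q n * ?X n))"
    by (simp add: eval_mpoly_sum eval_mpoly_single lookup_add power_add prod.distrib mult_ac)
  also have "\<dots> = eval_mpoly p x * eval_mpoly q x"
    by (simp add: sum_product eval_mpoly_eq_sum[OF finite_keys order_refl])
  finally show ?thesis .
qed

lemma eval_mpoly_Var:
  fixes x :: "'l::finite \<Rightarrow> 'k::comm_ring_1"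
  shows "eval_mpoly (Var \<alpha>) x = x \<alpha>"
proof -
  have "(\<Prod>\<beta>\<in>UNIV. x \<beta> ^ Poly_Mapping.lookup (Poly_Mapping.single \<alpha> 1) \<beta>) =
      (\<Prod>\<beta>\<in>UNIV. if \<beta> = \<alpha> then x \<alpha> else 1)"
    by (rule prod.cong) (auto simp: lookup_single when_def)
  then show ?thesis
    by (simp add: Var_def eval_mpoly_single)
qed


section \<open>Down-sets of join-irreducibles and the Hibi relations\<close>

text \<open>In a distributive lattice, join-irreducible elements are join-prime.\<close>

lemma jirr_le_sup_iff: "Rep_jirr z \<le> sup a b \<longleftrightarrow> Rep_jirr z \<le> a \<or> Rep_jirr z \<le> b"
proof
  assume "Rep_jirr z \<le> sup a b"
  then have "Rep_jirr z = sup (inf (Rep_jirr z) a) (inf (Rep_jirr z) b)"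
    by (metis inf.absorb1 inf_sup_distrib1)
  moreover have "join_irreducible (Rep_jirr z)"
    using Rep_jirr[of z] by simp
  ultimately have "Rep_jirr z = inf (Rep_jirr z) a \<or> Rep_jirr z = inf (Rep_jirr z) b"
    unfolding join_irreducible_def by blast
  then show "Rep_jirr z \<le> a \<or> Rep_jirr z \<le> b"
    by (metis inf.cobounded2)
qed (auto intro: le_supI1 le_supI2)

lemma jirr_le_Sup_fin_iff:
  assumes "finite A" "A \<noteq> {}"
  shows "Rep_jirr z \<le> Sup_fin A \<longleftrightarrow> (\<exists>a\<in>A. Rep_jirr z \<le> a)"
  using assms by (induction A rule: finite_ne_induct) (auto simp: jirr_le_sup_iff)

text \<open>
  Nonemptiness is essential: the least element of the lattice is join-irreducible and thus lies in
  every \<open>ideal_below \<alpha>\<close>.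
\<close>

lemma down_set_eq_ideal_below:
  assumes "D \<noteq> {}" and down: "\<And>y z. y \<le> z \<Longrightarrow> z \<in> D \<Longrightarrow> y \<in> D"
  obtains \<alpha> :: "'l::{finite,distrib_lattice}" where "ideal_below \<alpha> = D"
proof
  show "ideal_below (Sup_fin (Rep_jirr ` D)) = D"
    using assms by (auto simp: ideal_below_def jirr_le_Sup_fin_iff simp flip: less_eq_jirr_def)
qed

lemma f_ideal_nth: "f_ideal \<alpha> $ z = (if Rep_jirr z \<le> \<alpha> then 1 else 0)"
  by (simp add: f_ideal_def ideal_below_def axis_def)

lemma f_ideal_sup_inf: "f_ideal (sup \<alpha> \<beta>) + f_ideal (inf \<alpha> \<beta>) = f_ideal \<alpha> + f_ideal \<beta>"
  by (auto simp: vec_eq_iff f_ideal_nth jirr_le_sup_iff)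

lemma character_add: "t \<in> torus \<Longrightarrow> character (m + n) t = character m t * character n t"
  by (simp add: character_def torus_def power_int_add prod.distrib)

lemma hibi_embedding_in_variety:
  fixes t :: "'l::{finite,distrib_lattice} jirr \<Rightarrow> 'k::alg_closed_field"
  assumes "t \<in> torus"
  shows "hibi_embedding t \<in> hibi_variety"
proof -
  let ?x = "hibi_embedding t :: 'l \<Rightarrow> 'k"
  interpret module "(*) :: ('l, 'k) mpoly \<Rightarrow> _"
    by unfold_locales (auto simp: algebra_simps)
  have "(hibi_ideal :: ('l, 'k) mpoly set) \<subseteq> {p. eval_mpoly p ?x = 0}"
    unfolding hibi_ideal_def
  proof (rule span_minimal)
    show "subspace {p. eval_mpoly p ?x = 0}"
      by (auto simp: subspace_def eval_mpoly_0 eval_mpoly_add eval_mpoly_mult)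
    have "?x \<alpha> * ?x \<beta> = ?x (sup \<alpha> \<beta>) * ?x (inf \<alpha> \<beta>)" for \<alpha> \<beta>
      using assms by (simp add: hibi_embedding_def f_ideal_sup_inf flip: character_add)
    then show "{Var \<alpha> * Var \<beta> - Var (sup \<alpha> \<beta>) * Var (inf \<alpha> \<beta>) | \<alpha> \<beta>. True}
        \<subseteq> {p. eval_mpoly p ?x = 0}"
      by (auto simp: eval_mpoly_diff eval_mpoly_mult eval_mpoly_Var)
  qed
  then show ?thesis
    by (auto simp: hibi_variety_def zero_locus_def)
qed


section \<open>The coordinate ring as a semigroup algebra\<close>

text \<open>The exponent of the character to which a monomial restricts on the torus.\<close>

definition hibi_exponent :: "('l::{finite,distrib_lattice} \<Rightarrow>\<^sub>0 nat) \<Rightarrow> int ^ 'l jirr" where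
  "hibi_exponent m = (\<chi> z. \<Sum>\<alpha>\<in>UNIV. f_ideal \<alpha> $ z * int (Poly_Mapping.lookup m \<alpha>))"

lemma hibi_exponent_add: "hibi_exponent (m + n) = hibi_exponent m + hibi_exponent n"
  by (simp add: vec_eq_iff hibi_exponent_def lookup_add distrib_left sum.distrib)

lemma hibi_exponent_0: "hibi_exponent 0 = 0"
  by (simp add: vec_eq_iff hibi_exponent_def)

lemma hibi_exponent_single: "hibi_exponent (Poly_Mapping.single \<alpha> 1) = f_ideal \<alpha>"
proof -
  have "(\<Sum>\<beta>\<in>UNIV. f_ideal \<beta> $ z * int (Poly_Mapping.lookup (Poly_Mapping.single \<alpha> 1) \<beta>)) =
      (\<Sum>\<beta>\<in>UNIV. if \<beta> = \<alpha> then f_ideal \<alpha> $ z else 0)" for z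
    by (rule sum.cong) (auto simp: lookup_single when_def)
  then show ?thesis
    by (simp add: vec_eq_iff hibi_exponent_def)
qed

lemma power_int_sum:
  fixes x :: "'a::field"
  assumes "x \<noteq> 0"
  shows "x powi (\<Sum>i\<in>A. k i) = (\<Prod>i\<in>A. x powi k i)"
  using assms by (induction A rule: infinite_finite_induct) (auto simp: power_int_add)

lemma monomial_hibi_embedding:
  assumes "t \<in> torus"
  shows "(\<Prod>\<alpha>\<in>UNIV. hibi_embedding t \<alpha> ^ Poly_Mapping.lookup m \<alpha>) = character (hibi_exponent m) t"
proof -
  have "(\<Prod>\<alpha>\<in>UNIV. hibi_embedding t \<alpha> ^ Poly_Mapping.lookup m \<alpha>) =
      (\<Prod>\<alpha>\<in>UNIV. \<Prod>z\<in>UNIV. t z powi (f_ideal \<alpha> $ z * int (Poly_Mapping.lookup m \<alpha>)))"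
    by (simp add: hibi_embedding_def character_def power_int_mult flip: prod_power_distrib)
  also have "\<dots> = (\<Prod>z\<in>UNIV. \<Prod>\<alpha>\<in>UNIV. t z powi (f_ideal \<alpha> $ z * int (Poly_Mapping.lookup m \<alpha>)))"
    by (rule prod.swap)
  also have "\<dots> = character (hibi_exponent m) t"
    using assms by (simp add: character_def hibi_exponent_def torus_def power_int_sum)
  finally show ?thesis .
qed

text \<open>
  The support of a nonzero order-reversing \<open>u \<ge> 0\<close> is a nonempty down-set.  Since \<open>u\<close> takes integer
  values, it stays nonnegative and order-reversing after subtraction of the indicator function of
  its support.
\<close>

lemma antitone_cone_subset_range_hibi_exponent:
  fixes u :: "int ^ 'l::{finite,distrib_lattice} jirr"
  assumes "u \<in> antitone_cone"
  shows "u \<in> range hibi_exponent"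
  using assms
proof (induction "nat (\<Sum>z\<in>UNIV. u $ z)" arbitrary: u rule: less_induct)
  case less
  have nonneg: "0 \<le> u $ z" and antitone: "y \<le> z \<Longrightarrow> u $ z \<le> u $ y" for y z
    using less.prems by (auto simp: antitone_cone_def)
  show ?case
  proof (cases "u = 0")
    case True
    then show ?thesis
      using hibi_exponent_0 by (metis rangeI)
  next
    case False
    then obtain z\<^sub>0 where z\<^sub>0: "0 < u $ z\<^sub>0"
      using nonneg by (auto simp: vec_eq_iff less_le)
    obtain \<alpha> :: 'l where "ideal_below \<alpha> = {z. 0 < u $ z}"
      by (rule down_set_eq_ideal_below[of "{z. 0 < u $ z}"])
        (use z\<^sub>0 antitone in \<open>auto intro: less_le_trans\<close>)
    then have \<alpha>: "Rep_jirr z \<le> \<alpha> \<longleftrightarrow> 0 < u $ z" for z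
      by (auto simp: ideal_below_def set_eq_iff)
    let ?u' = "u - f_ideal \<alpha>"
    have u': "?u' $ z = (if 0 < u $ z then u $ z - 1 else 0)" for z
      using nonneg[of z] by (auto simp: f_ideal_nth \<alpha>)
    have "?u' $ z \<le> ?u' $ y" if "y \<le> z" for y z
      using antitone[OF that] unfolding u' by auto
    moreover have "0 \<le> ?u' $ z" for z
      unfolding u' by auto
    ultimately have "?u' \<in> antitone_cone"
      unfolding antitone_cone_def by blast
    moreover have "(\<Sum>z\<in>UNIV. ?u' $ z) < (\<Sum>z\<in>UNIV. u $ z)"
      using z\<^sub>0 nonneg by (intro sum_strict_mono_ex1) (auto simp: f_ideal_nth \<alpha>)
    moreover have "0 \<le> (\<Sum>z\<in>UNIV. ?u' $ z)"
      unfolding u' by (rule sum_nonneg) auto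
    ultimately obtain m where "?u' = hibi_exponent m"
      using less.hyps[of ?u'] by auto
    then have "u = hibi_exponent (m + Poly_Mapping.single \<alpha> 1)"
      by (simp add: hibi_exponent_add hibi_exponent_single del: One_nat_def) (metis diff_add_cancel)
    then show ?thesis
      by blast
  qed
qed

lemma range_hibi_exponent: "range hibi_exponent = antitone_cone"
proof
  show "range hibi_exponent \<subseteq> antitone_cone"
    by (auto simp: antitone_cone_def hibi_exponent_def f_ideal_nth less_eq_jirr_def
        intro!: sum_nonneg sum_mono) (meson order_trans)
qed (use antitone_cone_subset_range_hibi_exponent in blast)

lemma eval_mpoly_hibi_embedding:
  assumes "t \<in> torus"
  shows "eval_mpoly p (hibi_embedding t) =
    (\<Sum>m\<in>Poly_Mapping.keys p. Poly_Mapping.lookup p m * character (hibi_exponent m) t)"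
  by (simp add: eval_mpoly_eq_sum[OF finite_keys order_refl] monomial_hibi_embedding[OF assms])

lemma hibi_algebra_eq_evaluations:
  "(hibi_algebra :: (('l::{finite,distrib_lattice} jirr \<Rightarrow> 'k::alg_closed_field) \<Rightarrow> 'k) set) =
    {(\<lambda>t\<in>torus. eval_mpoly p (hibi_embedding t)) | p. True}"
proof -
  have "(\<lambda>t\<in>torus. restrict (eval_mpoly p) hibi_variety (hibi_embedding t)) =
      (\<lambda>t\<in>torus. eval_mpoly p (hibi_embedding (t :: 'l jirr \<Rightarrow> 'k)))" for p
    by (auto simp: restrict_def hibi_embedding_in_variety)
  then show ?thesis
    unfolding hibi_algebra_def coordinate_ring_def by (auto; metis)
qed

text \<open>
  Distinct monomials may restrict to the same character, so passing from a polynomial to a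
  combination of characters collects coefficients, while the converse picks one monomial for each
  character.
\<close>

lemma hibi_algebra_eq_semigroup_algebra:
  "(hibi_algebra :: (('l::{finite,distrib_lattice} jirr \<Rightarrow> 'k::alg_closed_field) \<Rightarrow> 'k) set) =
    semigroup_algebra antitone_cone"
proof (intro set_eqI iffI)
  fix \<phi> :: "('l jirr \<Rightarrow> 'k) \<Rightarrow> 'k"
  assume "\<phi> \<in> hibi_algebra"
  then obtain p where \<phi>: "\<phi> = (\<lambda>t\<in>torus. eval_mpoly p (hibi_embedding t))"
    unfolding hibi_algebra_eq_evaluations by blast
  let ?K = "Poly_Mapping.keys p"
  define c where "c n = (\<Sum>m | m \<in> ?K \<and> hibi_exponent m = n. Poly_Mapping.lookup p m)" for n
  have "eval_mpoly p (hibi_embedding t) = (\<Sum>n\<in>hibi_exponent ` ?K. c n * character n t)"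
    if "t \<in> torus" for t
    unfolding eval_mpoly_hibi_embedding[OF that] c_def
    by (subst sum.image_gen[OF finite_keys, of _ _ hibi_exponent])
      (auto simp: sum_distrib_right intro!: sum.cong)
  then have "\<phi> = (\<lambda>t\<in>torus. \<Sum>n\<in>hibi_exponent ` ?K. c n * character n t)"
    unfolding \<phi> by (intro restrict_ext)
  moreover have "hibi_exponent ` ?K \<subseteq> antitone_cone"
    using range_hibi_exponent by blast
  ultimately show "\<phi> \<in> semigroup_algebra antitone_cone"
    unfolding semigroup_algebra_def
    by (intro CollectI exI[of _ "hibi_exponent ` ?K"] exI[of _ c]) simp
next
  fix \<phi> :: "('l jirr \<Rightarrow> 'k) \<Rightarrow> 'k"
  assume "\<phi> \<in> semigroup_algebra antitone_cone"
  then obtain A c where A: "finite A" "A \<subseteq> antitone_cone"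
    and \<phi>: "\<phi> = (\<lambda>t\<in>torus. \<Sum>n\<in>A. c n * character n t)"
    unfolding semigroup_algebra_def by blast
  define g :: "int ^ 'l jirr \<Rightarrow> 'l \<Rightarrow>\<^sub>0 nat" where "g = inv hibi_exponent"
  have g: "hibi_exponent (g n) = n" if "n \<in> A" for n
    using that A(2) unfolding g_def by (intro f_inv_into_f) (auto simp: range_hibi_exponent)
  define p where "p = (\<Sum>n\<in>A. Poly_Mapping.single (g n) (c n))"
  have "eval_mpoly p (hibi_embedding t) = (\<Sum>n\<in>A. c n * character n t)" if "t \<in> torus" for t
    by (simp add: p_def eval_mpoly_sum eval_mpoly_single monomial_hibi_embedding[OF that] g)
  then have "\<phi> = (\<lambda>t\<in>torus. eval_mpoly p (hibi_embedding t))"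
    unfolding \<phi> by (intro restrict_ext) simp
  then show "\<phi> \<in> hibi_algebra"
    unfolding hibi_algebra_eq_evaluations by blast
qed


section \<open>The cone of the Hibi toric variety\<close>

theorem proposition4p7:
  shows "(hibi_cone TYPE('k::alg_closed_field) :: (real ^ 'l::{finite,distrib_lattice} jirr) set) =
    convex_cone hull ({e_vec z | z. z \<in> maximal_jirr} \<union> {v_vec y y' | y y'. (y, y') \<in> covers_jirr})"
proof -
  let ?\<sigma>\<^sub>0 = "convex_cone hull cover_generators :: (real ^ 'l jirr) set"
  have "hibi_cone TYPE('k) = ?\<sigma>\<^sub>0"
    unfolding hibi_cone_def hibi_algebra_eq_semigroup_algebra
  proof (intro the_equality conjI)
    show "semigroup_algebra antitone_cone = semigroup_algebra {m. real_vec m \<in> dual_cone ?\<sigma>\<^sub>0}"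
      by (simp add: dual_cone_hull dual_cone_cover_generators real_vec_in_antitone_cone_iff)
  next
    fix \<sigma> :: "(real ^ 'l jirr) set"
    assume \<sigma>: "rational_polyhedral_cone \<sigma> \<and> strongly_convex \<sigma> \<and>
      (semigroup_algebra antitone_cone :: (('l jirr \<Rightarrow> 'k) \<Rightarrow> 'k) set) =
        semigroup_algebra {m. real_vec m \<in> dual_cone \<sigma>}"
    then have "antitone_cone = {m. real_vec m \<in> dual_cone \<sigma>}"
      by (intro semigroup_algebra_inject) blast
    with \<sigma> show "\<sigma> = ?\<sigma>\<^sub>0"
      by (intro cone_eq_cover_hull) auto
  qed (rule rational_polyhedral_cover_hull strongly_convex_cover_hull)+
  also have "cover_generators = {e_vec z | z. z \<in> maximal_jirr} \<union>
      {v_vec y y' | y y' :: 'l jirr. (y, y') \<in> covers_jirr}"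
    by (simp add: cover_generators_def maximal_jirr_def covers_jirr_def)
  finally show ?thesis .
qed

end
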